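(* Let $h(t)=e^{1/t}$ for $t\in\mathbb{R}\setminus\{0\}$. For every $i\in\mathbb{N}$ and every real $t\ne 0$, $$h^{(i)}(t)=(-1)^i e^{1/t}\frac{1}{t^{2i}}\sum_{k=0}^{i-1}a_{i,k}t^{k},$$ where $$a_{i,k}=\binom{i}{k}\binom{i-1}{k}k!$$ for all $0\le k\le i-1$.
   Context: $\mathbb{N}$ denotes the set of positive integers, and $h^{(i)}$ denotes the $i$-th derivative of $h$. *)

theory Defs
  imports "HOL-Analysis.Analysis"
begin

(* Intended for t \<noteq> 0 only. The totalised value at 0 does not affect the derivatives at points t \<noteq> 0. *)
definition exp_recip :: "real \<Rightarrow> real" where
  "exp_recip t = exp (1 / t)"

(* Intended for k \<le> i - 1. *)
definition exp_recip_coeff :: "nat \<Rightarrow> nat \<Rightarrow> nat" where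
  "exp_recip_coeff i k = (i choose k) * ((i - 1) choose k) * fact k"

end

theory Submission
  imports Defs
begin

text \<open>
  Put \<open>P i t = (\<Sum>k\<le>i. a i k * t ^ k)\<close>, where \<open>a\<close> is the claimed coefficient.
  Differentiating \<open>(-1) ^ i * exp (1 / t) * P i t / t ^ (2 * i)\<close> reproduces this shape with
  \<open>i + 1\<close> in place of \<open>i\<close>, provided that
  \<open>P (i + 1) t = P i t + 2 * i * t * P i t - t\<^sup>2 * P' i t\<close>, where \<open>P' i\<close> is the derivative
  of \<open>P i\<close>. All constant coefficients are \<open>1\<close>, so comparing coefficients, this is the recurrence
  \<open>a (i + 1) (k + 1) = a i (k + 1) + (2 * i - k) * a i k\<close>
  (lemma \<open>exp_recip_coeff_Suc_Suc\<close>), which follows from Pascal's rule and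
  \<open>(k + 1) * (n choose (k + 1)) = (n - k) * (n choose k)\<close>.
  The formula for the iterated derivatives then follows by induction on the order. The induction
  starts at order \<open>0\<close>, where the closed form also holds.
\<close>

lemma Suc_times_binomial_Suc_real:
  "real (Suc k) * real (n choose Suc k) = (real n - real k) * real (n choose k)"
  using gbinomial_mult_1[of "real n" k]
  by (simp add: binomial_gbinomial algebra_simps)

lemma exp_recip_coeff_0 [simp]: "exp_recip_coeff i 0 = 1"
  by (simp add: exp_recip_coeff_def)

lemma exp_recip_coeff_eq_0: "i < k \<Longrightarrow> exp_recip_coeff i k = 0"
  by (simp add: exp_recip_coeff_def)

lemma exp_recip_coeff_Suc_Suc:
  "real (exp_recip_coeff (Suc i) (Suc k)) =
     real (exp_recip_coeff i (Suc k)) + (2 * real i - real k) * real (exp_recip_coeff i k)"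
proof (cases i)
  case 0
  then show ?thesis by (cases k) (simp_all add: exp_recip_coeff_def)
next
  case (Suc n)
  define A A' B B' where "A = real (Suc n choose k)" and "A' = real (Suc n choose Suc k)"
    and "B = real (n choose k)" and "B' = real (n choose Suc k)"
  have A': "(real k + 1) * A' = (real n + 1 - real k) * A"
    using Suc_times_binomial_Suc_real[of k "Suc n"] by (simp add: A_def A'_def algebra_simps)
  have B': "(real k + 1) * B' = (real n - real k) * B"
    using Suc_times_binomial_Suc_real[of k n] by (simp add: B_def B'_def algebra_simps)
  have "(A + A') * (B + B') * (real k + 1) =
      A' * B' * (real k + 1) + A * B * (real k + 1)
        + B * ((real k + 1) * A') + A * ((real k + 1) * B')"
    by (simp add: algebra_simps)
  also have "\<dots> = A' * B' * (real k + 1) + (2 * real i - real k) * (A * B)"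
    unfolding A' B' Suc by (simp add: algebra_simps)
  finally have key: "(A + A') * (B + B') * (real k + 1) =
      A' * B' * (real k + 1) + (2 * real i - real k) * (A * B)" .
  have "real (exp_recip_coeff (Suc i) (Suc k)) = (A + A') * (B + B') * (real k + 1) * fact k"
    by (simp add: exp_recip_coeff_def Suc A_def A'_def B_def B'_def algebra_simps)
  also have "\<dots> = A' * B' * ((real k + 1) * fact k) + (2 * real i - real k) * (A * B * fact k)"
    unfolding key by (simp add: algebra_simps)
  also have "A' * B' * ((real k + 1) * fact k) = real (exp_recip_coeff i (Suc k))"
    by (simp add: exp_recip_coeff_def Suc A'_def B'_def del: binomial_Suc_Suc)
       (simp add: algebra_simps)
  also have "A * B * fact k = real (exp_recip_coeff i k)"
    by (simp add: exp_recip_coeff_def Suc A_def B_def)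
  finally show ?thesis .
qed

text \<open>
  The polynomial factor of the \<open>i\<close>-th derivative. The summation runs up to \<open>i\<close> rather than
  \<open>i - 1\<close>, so that the recurrence is uniform in \<open>i\<close>; for \<open>i \<ge> 1\<close> the extra term vanishes.
\<close>
definition exp_recip_poly :: "nat \<Rightarrow> real \<Rightarrow> real" where
  "exp_recip_poly i t = (\<Sum>k\<le>i. real (exp_recip_coeff i k) * t ^ k)"

lemma exp_recip_poly_eq:
  assumes "i \<ge> 1"
  shows "exp_recip_poly i t = (\<Sum>k = 0..i - 1. real (exp_recip_coeff i k) * t ^ k)"
proof -
  obtain n where i: "i = Suc n" using assms by (cases i) auto
  show ?thesis
    by (simp add: exp_recip_poly_def i atLeast0AtMost) (simp add: exp_recip_coeff_def)
qed

text \<open>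
  The derivative of \<open>exp_recip_poly i\<close>, term by term; the factor \<open>k\<close> cancels the term
  \<open>k = 0\<close>, where \<open>k - 1\<close> is truncated.
\<close>
definition exp_recip_poly_deriv :: "nat \<Rightarrow> real \<Rightarrow> real" where
  "exp_recip_poly_deriv i t = (\<Sum>k\<le>i. real (exp_recip_coeff i k) * (real k * t ^ (k - 1)))"

lemma exp_recip_poly_has_derivative:
  "(exp_recip_poly i has_real_derivative exp_recip_poly_deriv i t) (at t)"
  unfolding exp_recip_poly_def exp_recip_poly_deriv_def
  by (auto intro!: derivative_eq_intros sum.cong)

lemma exp_recip_poly_Suc:
  "exp_recip_poly (Suc i) t =
     exp_recip_poly i t + 2 * real i * t * exp_recip_poly i t - t\<^sup>2 * exp_recip_poly_deriv i t"
proof -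
  let ?a = "\<lambda>k. real (exp_recip_coeff i k)"
  have deriv: "t * exp_recip_poly_deriv i t = (\<Sum>k\<le>i. real k * ?a k * t ^ k)"
    unfolding exp_recip_poly_deriv_def sum_distrib_left
  proof (rule sum.cong)
    fix k show "t * (?a k * (real k * t ^ (k - 1))) = real k * ?a k * t ^ k"
      by (cases k) simp_all
  qed simp
  have "exp_recip_poly i t = (\<Sum>k\<le>Suc i. ?a k * t ^ k)"
    by (simp add: exp_recip_poly_def exp_recip_coeff_eq_0)
  also have "\<dots> = 1 + (\<Sum>k\<le>i. ?a (Suc k) * t ^ Suc k)"
    by (subst sum.atMost_Suc_shift) simp
  finally have shift: "exp_recip_poly i t = 1 + (\<Sum>k\<le>i. ?a (Suc k) * t ^ Suc k)" .
  have "exp_recip_poly (Suc i) t =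
      1 + (\<Sum>k\<le>i. real (exp_recip_coeff (Suc i) (Suc k)) * t ^ Suc k)"
    unfolding exp_recip_poly_def by (subst sum.atMost_Suc_shift) simp
  also have "(\<Sum>k\<le>i. real (exp_recip_coeff (Suc i) (Suc k)) * t ^ Suc k) =
      (\<Sum>k\<le>i. ?a (Suc k) * t ^ Suc k + 2 * real i * t * (?a k * t ^ k)
        - t * (real k * ?a k * t ^ k))"
    by (rule sum.cong) (simp_all add: exp_recip_coeff_Suc_Suc algebra_simps)
  also have "\<dots> = (\<Sum>k\<le>i. ?a (Suc k) * t ^ Suc k) + 2 * real i * t * exp_recip_poly i t
      - t * (t * exp_recip_poly_deriv i t)"
    unfolding deriv exp_recip_poly_def
    by (simp only: sum.distrib sum_subtractf sum_distrib_left)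
  finally show ?thesis using shift by (simp add: power2_eq_square)
qed

text \<open>The closed form of the \<open>i\<close>-th derivative away from \<open>0\<close>.\<close>
definition exp_recip_closed :: "nat \<Rightarrow> real \<Rightarrow> real" where
  "exp_recip_closed i t = (-1) ^ i * exp (1 / t) * (1 / t ^ (2 * i)) * exp_recip_poly i t"

lemma exp_recip_closed_has_derivative:
  assumes "t \<noteq> 0"
  shows "(exp_recip_closed i has_real_derivative exp_recip_closed (Suc i) t) (at t)"
proof -
  let ?P = "exp_recip_poly i t" and ?P' = "exp_recip_poly_deriv i t"
  have E: "((\<lambda>t. exp (1 / t)) has_real_derivative - exp (1 / t) / t\<^sup>2) (at t)"
    using assms by (auto intro!: derivative_eq_intros simp: power2_eq_square)
  have Q: "((\<lambda>t. 1 / t ^ (2 * i)) has_real_derivative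
      - (2 * real i) / (t * t ^ (2 * i))) (at t)"
  proof (cases i)
    case (Suc n)
    have "((\<lambda>t. t ^ (2 * i)) has_real_derivative 2 * real i * t ^ (2 * n + 1)) (at t)"
      using DERIV_pow[of "2 * i" t UNIV] by (simp add: Suc)
    then have "((\<lambda>t. 1 / t ^ (2 * i)) has_real_derivative
        - (2 * real i * t ^ (2 * n + 1)) / (t ^ (2 * i) * t ^ (2 * i))) (at t)"
      using assms DERIV_divide[OF DERIV_const[of 1]] by fastforce
    moreover have "t ^ (2 * i) = t * t ^ (2 * n + 1)"
      by (simp add: Suc)
    ultimately show ?thesis using assms by simp
  qed simp
  have "(exp_recip_closed i has_real_derivative
      (-1) ^ i * (- exp (1 / t) / t\<^sup>2 * (1 / t ^ (2 * i)) * ?P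
        + exp (1 / t) * (- (2 * real i) / (t * t ^ (2 * i))) * ?P
        + exp (1 / t) * (1 / t ^ (2 * i)) * ?P')) (at t)"
    unfolding exp_recip_closed_def
    by (rule derivative_eq_intros E Q exp_recip_poly_has_derivative refl)+
       (simp add: algebra_simps)
  moreover have "(-1) ^ i * (- exp (1 / t) / t\<^sup>2 * (1 / t ^ (2 * i)) * ?P
        + exp (1 / t) * (- (2 * real i) / (t * t ^ (2 * i))) * ?P
        + exp (1 / t) * (1 / t ^ (2 * i)) * ?P') =
      (-1) ^ Suc i * exp (1 / t) * (1 / (t\<^sup>2 * t ^ (2 * i)))
        * (?P + 2 * real i * t * ?P - t\<^sup>2 * ?P')"
    using assms by (simp add: field_simps power2_eq_square)
  moreover have "t ^ (2 * Suc i) = t\<^sup>2 * t ^ (2 * i)"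
    by (simp add: power2_eq_square)
  ultimately show ?thesis
    by (simp only: exp_recip_closed_def exp_recip_poly_Suc)
qed

lemma has_derivative_transform_nonzero:
  fixes f g :: "real \<Rightarrow> real"
  assumes "(g has_real_derivative D) (at t)" and "t \<noteq> 0" and "\<And>s. s \<noteq> 0 \<Longrightarrow> f s = g s"
  shows "(f has_real_derivative D) (at t)"
  by (rule has_field_derivative_transform_within_open[OF assms(1), of "- {0}"])
     (use assms in auto)

lemma deriv_funpow_exp_recip:
  assumes "t \<noteq> 0"
  shows "(deriv ^^ i) exp_recip t = exp_recip_closed i t"
  using assms
proof (induction i arbitrary: t)
  case 0
  then show ?case
    by (simp add: exp_recip_def exp_recip_closed_def exp_recip_poly_def)
next
  case (Suc i)
  have "((deriv ^^ i) exp_recip has_real_derivative exp_recip_closed (Suc i) t) (at t)"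
    using exp_recip_closed_has_derivative[OF Suc.prems] Suc.prems Suc.IH
    by (rule has_derivative_transform_nonzero)
  then show ?case by (simp add: DERIV_imp_deriv)
qed

theorem theorem1:
  fixes i :: nat and t :: real
  assumes "i \<ge> 1" and "t \<noteq> 0"
  shows "(deriv ^^ (i - 1)) exp_recip differentiable (at t) \<and>
    (deriv ^^ i) exp_recip t =
      (-1) ^ i * exp (1 / t) * (1 / t ^ (2 * i)) *
        (\<Sum>k = 0..i - 1. real (exp_recip_coeff i k) * t ^ k)"
proof
  have "((deriv ^^ (i - 1)) exp_recip has_real_derivative exp_recip_closed (Suc (i - 1)) t) (at t)"
    using exp_recip_closed_has_derivative[OF assms(2)] assms(2) deriv_funpow_exp_recip
    by (rule has_derivative_transform_nonzero)
  then show "(deriv ^^ (i - 1)) exp_recip differentiable (at t)"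
    using real_differentiable_def by blast
  show "(deriv ^^ i) exp_recip t =
      (-1) ^ i * exp (1 / t) * (1 / t ^ (2 * i)) *
        (\<Sum>k = 0..i - 1. real (exp_recip_coeff i k) * t ^ k)"
    using deriv_funpow_exp_recip[OF assms(2), of i] exp_recip_poly_eq[OF assms(1), of t]
    by (simp add: exp_recip_closed_def)
qed

end
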